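(* For every $i\in\{1,2,\ldots,p\}$, the individual admissible set $$\mathcal{A}_i = \{ \bar{x} \in \mathcal{G}_i \mid \exists\, u \in \mathcal{U} : x^{(\bar{x},u)}(t) \in \mathcal{G}_i \ \ \forall t \geq 0 \}$$ of the linear system $\dot x(t)=Ax(t)+Bu(t)$ subject to the affine state constraint $H_i x(t)+h_i\le 0$ is convex.
   Context: $A\in\mathbb{R}^{n\times n}$, $B\in\mathbb{R}^{n\times m}$; $\mathbb{U}\subset\mathbb{R}^m$ is nonempty, convex and compact; $\mathcal{U}$ is the set of Lebesgue-measurable functions $u:[0,\infty)\to\mathbb{U}$. For $x_0\in\mathbb{R}^n$ and $u\in\mathcal{U}$, $x^{(x_0,u)}$ denotes the absolutely continuous solution of $\dot x(t)=Ax(t)+Bu(t)$, $x(0)=x_0$. $H\in\mathbb{R}^{p\times n}$ has rows $H_1,\dots,H_p$, all nonzero, and $h\in\mathbb{R}^p$ has components $h_1,\dots,h_p$. $\mathcal{G}_i=\{x\in\mathbb{R}^n \mid H_ix+h_i\le0\}$. It is assumed that $\mathcal{G}=\{x\in\mathbb{R}^n\mid H_ix+h_i\le 0 \text{ for all } i\}$ has nonempty interior and that the set $\{x\in\mathbb{R}^n \mid \exists\, i: H_ix+h_i=0\}$ is nonempty. *)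

theory Defs
  imports "HOL-Analysis.Analysis"
begin

text \<open>The usual \<open>\<epsilon>\<close>-\<open>\<delta>\<close> notion for functions on a compact interval (\<open>absolutely_continuous\<close> in the
  library is the notion for measures). \<open>D\<close> ranges over the finite families of
  non-overlapping compact subintervals \<open>k = {Inf k..Sup k}\<close> of \<open>{a..b}\<close>.\<close>

definition abs_continuous_on :: "real \<Rightarrow> real \<Rightarrow> (real \<Rightarrow> 'a::real_normed_vector) \<Rightarrow> bool" where
  "abs_continuous_on a b f \<longleftrightarrow>
     (\<forall>\<epsilon>>0. \<exists>\<delta>>0. \<forall>D. D division_of \<Union>D \<and> \<Union>D \<subseteq> {a..b} \<and> (\<Sum>k\<in>D. Sup k - Inf k) < \<delta>
        \<longrightarrow> (\<Sum>k\<in>D. norm (f (Sup k) - f (Inf k))) < \<epsilon>)"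

text \<open>Functions on \<open>[0,\<infinity>)\<close> are total functions on the reals whose values at negative arguments
  are irrelevant.\<close>

definition admissible_controls :: "(real ^ 'm) set \<Rightarrow> (real \<Rightarrow> real ^ 'm) set" where
  "admissible_controls U =
     {u. u \<in> borel_measurable (lebesgue_on {0..}) \<and> (\<forall>t\<ge>0. u t \<in> U)}"

text \<open>\<open>x\<close> is the Caratheodory solution on \<open>[0,\<infinity>)\<close>: locally absolutely continuous, with the
  differential equation holding almost everywhere. For an admissible control with bounded values
  it exists and is unique on \<open>[0,\<infinity>)\<close>.\<close>

definition is_solution ::
  "real ^ 'n ^ 'n \<Rightarrow> real ^ 'm ^ 'n \<Rightarrow> real ^ 'n \<Rightarrow> (real \<Rightarrow> real ^ 'm) \<Rightarrow> (real \<Rightarrow> real ^ 'n) \<Rightarrow> bool" where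
  "is_solution A B x0 u x \<longleftrightarrow>
     (\<forall>T\<ge>0. abs_continuous_on 0 T x) \<and>
     (AE t in lebesgue_on {0..}.
        (x has_vector_derivative (A *v x t + B *v u t)) (at t within {0..})) \<and>
     x 0 = x0"

definition constraint_set :: "real ^ 'n ^ 'p \<Rightarrow> real ^ 'p \<Rightarrow> 'p \<Rightarrow> (real ^ 'n) set" where
  "constraint_set H h i = {x. row i H \<bullet> x + h $ i \<le> 0}"

definition admissible_set ::
  "real ^ 'n ^ 'n \<Rightarrow> real ^ 'm ^ 'n \<Rightarrow> (real ^ 'm) set \<Rightarrow> real ^ 'n ^ 'p \<Rightarrow> real ^ 'p \<Rightarrow> 'p
    \<Rightarrow> (real ^ 'n) set" where
  "admissible_set A B U H h i =
     {x0 \<in> constraint_set H h i.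
        \<exists>u\<in>admissible_controls U. \<exists>x. is_solution A B x0 u x \<and>
          (\<forall>t\<ge>0. x t \<in> constraint_set H h i)}"

end

theory Submission
  imports Defs
begin

text \<open>The system is linear, so superposition holds: if \<open>x\<close> solves it for the control \<open>u\<close> and \<open>y\<close>
  for \<open>v\<close>, then \<open>a x + b y\<close> solves it for \<open>a u + b v\<close>, from the corresponding combination of
  the initial states (\<open>is_solution_linear_combination\<close>). For a convex combination the combined
  control still takes its values in the convex set \<open>U\<close> (\<open>convex_admissible_controls\<close>), and the
  combined trajectory stays in the half-space, which is convex (\<open>convex_constraint_set\<close>).
  Hence the combination of two witnesses is a witness for the combined initial state.\<close>

lemma abs_continuous_on_add:
  assumes "abs_continuous_on a b f" and "abs_continuous_on a b g"
  shows "abs_continuous_on a b (\<lambda>t. f t + g t)"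
  unfolding abs_continuous_on_def
proof (intro allI impI)
  fix \<epsilon> :: real assume "\<epsilon> > 0"
  hence half: "\<epsilon> / 2 > 0" by simp
  obtain \<delta>1 where "\<delta>1 > 0" and \<delta>1: "\<And>D. D division_of \<Union>D \<and> \<Union>D \<subseteq> {a..b} \<and>
      (\<Sum>k\<in>D. Sup k - Inf k) < \<delta>1 \<Longrightarrow> (\<Sum>k\<in>D. norm (f (Sup k) - f (Inf k))) < \<epsilon> / 2"
    using assms(1) half unfolding abs_continuous_on_def by meson
  obtain \<delta>2 where "\<delta>2 > 0" and \<delta>2: "\<And>D. D division_of \<Union>D \<and> \<Union>D \<subseteq> {a..b} \<and>
      (\<Sum>k\<in>D. Sup k - Inf k) < \<delta>2 \<Longrightarrow> (\<Sum>k\<in>D. norm (g (Sup k) - g (Inf k))) < \<epsilon> / 2"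
    using assms(2) half unfolding abs_continuous_on_def by meson
  show "\<exists>\<delta>>0. \<forall>D. D division_of \<Union>D \<and> \<Union>D \<subseteq> {a..b} \<and> (\<Sum>k\<in>D. Sup k - Inf k) < \<delta>
      \<longrightarrow> (\<Sum>k\<in>D. norm (f (Sup k) + g (Sup k) - (f (Inf k) + g (Inf k)))) < \<epsilon>"
  proof (intro exI[of _ "min \<delta>1 \<delta>2"] conjI allI impI)
    show "min \<delta>1 \<delta>2 > 0" using \<open>\<delta>1 > 0\<close> \<open>\<delta>2 > 0\<close> by simp
  next
    fix D assume D: "D division_of \<Union>D \<and> \<Union>D \<subseteq> {a..b} \<and> (\<Sum>k\<in>D. Sup k - Inf k) < min \<delta>1 \<delta>2"
    have "(\<Sum>k\<in>D. norm (f (Sup k) + g (Sup k) - (f (Inf k) + g (Inf k))))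
        \<le> (\<Sum>k\<in>D. norm (f (Sup k) - f (Inf k)) + norm (g (Sup k) - g (Inf k)))"
      by (intro sum_mono) (metis add_diff_add norm_triangle_ineq)
    also have "\<dots> = (\<Sum>k\<in>D. norm (f (Sup k) - f (Inf k))) + (\<Sum>k\<in>D. norm (g (Sup k) - g (Inf k)))"
      by (rule sum.distrib)
    also have "\<dots> < \<epsilon>"
      using \<delta>1[of D] \<delta>2[of D] D by simp
    finally show "(\<Sum>k\<in>D. norm (f (Sup k) + g (Sup k) - (f (Inf k) + g (Inf k)))) < \<epsilon>" .
  qed
qed

lemma abs_continuous_on_scaleR:
  assumes "abs_continuous_on a b f"
  shows "abs_continuous_on a b (\<lambda>t. c *\<^sub>R f t)"
  unfolding abs_continuous_on_def
proof (intro allI impI)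
  fix \<epsilon> :: real assume "\<epsilon> > 0"
  \<comment> \<open>The added 1 keeps the tolerance for \<open>f\<close> finite and positive when \<open>c = 0\<close>.\<close>
  hence "\<epsilon> / (\<bar>c\<bar> + 1) > 0" by simp
  then obtain \<delta> where "\<delta> > 0" and \<delta>: "\<And>D. D division_of \<Union>D \<and> \<Union>D \<subseteq> {a..b} \<and>
      (\<Sum>k\<in>D. Sup k - Inf k) < \<delta> \<Longrightarrow>
      (\<Sum>k\<in>D. norm (f (Sup k) - f (Inf k))) < \<epsilon> / (\<bar>c\<bar> + 1)"
    using assms unfolding abs_continuous_on_def by meson
  show "\<exists>\<delta>>0. \<forall>D. D division_of \<Union>D \<and> \<Union>D \<subseteq> {a..b} \<and> (\<Sum>k\<in>D. Sup k - Inf k) < \<delta>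
      \<longrightarrow> (\<Sum>k\<in>D. norm (c *\<^sub>R f (Sup k) - c *\<^sub>R f (Inf k))) < \<epsilon>"
  proof (intro exI[of _ \<delta>] conjI allI impI)
    fix D assume "D division_of \<Union>D \<and> \<Union>D \<subseteq> {a..b} \<and> (\<Sum>k\<in>D. Sup k - Inf k) < \<delta>"
    hence less: "(\<Sum>k\<in>D. norm (f (Sup k) - f (Inf k))) < \<epsilon> / (\<bar>c\<bar> + 1)" (is "?S < _")
      by (rule \<delta>)
    have "(\<Sum>k\<in>D. norm (c *\<^sub>R f (Sup k) - c *\<^sub>R f (Inf k))) = \<bar>c\<bar> * ?S"
      by (simp add: sum_distrib_left flip: scaleR_diff_right)
    also have "\<dots> \<le> (\<bar>c\<bar> + 1) * ?S"
      by (intro mult_right_mono sum_nonneg) auto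
    also have "\<dots> < \<epsilon>"
      using less by (simp add: pos_less_divide_eq mult.commute)
    finally show "(\<Sum>k\<in>D. norm (c *\<^sub>R f (Sup k) - c *\<^sub>R f (Inf k))) < \<epsilon>" .
  qed (fact \<open>\<delta> > 0\<close>)
qed

text \<open>Superposition. The two exceptional null sets on which the differential equations fail are
  joined into one, and outside it the right-hand side is linear in the pair (state, control).\<close>

lemma is_solution_linear_combination:
  assumes x: "is_solution A B x0 u x" and y: "is_solution A B y0 v y"
  shows "is_solution A B (a *\<^sub>R x0 + b *\<^sub>R y0) (\<lambda>t. a *\<^sub>R u t + b *\<^sub>R v t) (\<lambda>t. a *\<^sub>R x t + b *\<^sub>R y t)"
  unfolding is_solution_def
proof (intro conjI allI impI)
  fix T :: real assume "T \<ge> 0"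
  with x y show "abs_continuous_on 0 T (\<lambda>t. a *\<^sub>R x t + b *\<^sub>R y t)"
    unfolding is_solution_def by (intro abs_continuous_on_add abs_continuous_on_scaleR) auto
next
  have "AE t in lebesgue_on {0..}.
      (x has_vector_derivative (A *v x t + B *v u t)) (at t within {0..})"
    and "AE t in lebesgue_on {0..}.
      (y has_vector_derivative (A *v y t + B *v v t)) (at t within {0..})"
    using x y unfolding is_solution_def by auto
  then show "AE t in lebesgue_on {0..}. ((\<lambda>t. a *\<^sub>R x t + b *\<^sub>R y t) has_vector_derivative
      (A *v (a *\<^sub>R x t + b *\<^sub>R y t) + B *v (a *\<^sub>R u t + b *\<^sub>R v t))) (at t within {0..})"
  proof eventually_elim
    case (elim t)
    have "A *v (a *\<^sub>R x t + b *\<^sub>R y t) + B *v (a *\<^sub>R u t + b *\<^sub>R v t)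
        = a *\<^sub>R (A *v x t + B *v u t) + b *\<^sub>R (A *v y t + B *v v t)"
      by (simp add: matrix_vector_right_distrib matrix_vector_mult_scaleR algebra_simps)
    moreover have "((\<lambda>t. a *\<^sub>R x t + b *\<^sub>R y t) has_vector_derivative
        (a *\<^sub>R (A *v x t + B *v u t) + b *\<^sub>R (A *v y t + B *v v t))) (at t within {0..})"
      by (intro has_vector_derivative_add
          bounded_linear.has_vector_derivative[OF bounded_linear_scaleR_right] elim)
    ultimately show ?case by simp
  qed
next
  show "a *\<^sub>R x 0 + b *\<^sub>R y 0 = a *\<^sub>R x0 + b *\<^sub>R y0"
    using x y by (simp add: is_solution_def)
qed

lemma convex_admissible_controls:
  assumes "convex U" and "u \<in> admissible_controls U" and "v \<in> admissible_controls U"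
    and "a \<ge> 0" and "b \<ge> 0" and "a + b = 1"
  shows "(\<lambda>t. a *\<^sub>R u t + b *\<^sub>R v t) \<in> admissible_controls U"
  using assms unfolding admissible_controls_def by (auto intro: convexD)

lemma convex_constraint_set: "convex (constraint_set H h i)"
proof -
  have "constraint_set H h i = {x. row i H \<bullet> x \<le> - h $ i}"
    by (auto simp: constraint_set_def)
  then show ?thesis by (simp add: convex_halfspace_le)
qed

theorem proposition5:
  fixes A :: "real ^ 'n ^ 'n" and B :: "real ^ 'm ^ 'n" and U :: "(real ^ 'm) set"
    and H :: "real ^ 'n ^ 'p" and h :: "real ^ 'p"
  assumes "U \<noteq> {}" and "convex U" and "compact U"
    and "\<forall>i. row i H \<noteq> 0"
    and "interior {x. \<forall>i. row i H \<bullet> x + h $ i \<le> 0} \<noteq> {}"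
    and "{x. \<exists>i. row i H \<bullet> x + h $ i = 0} \<noteq> {}"
  shows "\<forall>i. convex (admissible_set A B U H h i)"
proof (intro allI convexI)
  fix i x0 y0 and a b :: real
  assume x0: "x0 \<in> admissible_set A B U H h i" and y0: "y0 \<in> admissible_set A B U H h i"
    and ab: "a \<ge> 0" "b \<ge> 0" "a + b = 1"
  let ?G = "constraint_set H h i"
  obtain u x where "u \<in> admissible_controls U" and "is_solution A B x0 u x"
    and "\<forall>t\<ge>0. x t \<in> ?G"
    using x0 unfolding admissible_set_def by blast
  moreover obtain v y where "v \<in> admissible_controls U" and "is_solution A B y0 v y"
    and "\<forall>t\<ge>0. y t \<in> ?G"
    using y0 unfolding admissible_set_def by blast
  ultimately have "(\<lambda>t. a *\<^sub>R u t + b *\<^sub>R v t) \<in> admissible_controls U"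
    and "is_solution A B (a *\<^sub>R x0 + b *\<^sub>R y0)
      (\<lambda>t. a *\<^sub>R u t + b *\<^sub>R v t) (\<lambda>t. a *\<^sub>R x t + b *\<^sub>R y t)"
    and "\<forall>t\<ge>0. a *\<^sub>R x t + b *\<^sub>R y t \<in> ?G"
    using convex_admissible_controls[OF \<open>convex U\<close> _ _ ab] is_solution_linear_combination
      convexD[OF convex_constraint_set _ _ ab]
    by blast+
  moreover have "a *\<^sub>R x0 + b *\<^sub>R y0 \<in> ?G"
    using x0 y0 ab by (auto simp: admissible_set_def intro: convexD[OF convex_constraint_set])
  ultimately show "a *\<^sub>R x0 + b *\<^sub>R y0 \<in> admissible_set A B U H h i"
    unfolding admissible_set_def by blast
qed

end
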